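(* Consider a decentralized learning system on an undirected graph $\mathcal{G}=(V,E)$ under the average aggregation rule. In this system $\hat{i}$ is a Byzantine node, attempting to add a malicious vector $\hat{x}\in\mathbb{R}^d$ to the estimate of a benign node $i_{\tau'}$. The shortest distance (number of edges) between them is $\tau'$, and $\{i_s\}_{s=1}^{\tau'-1}$ are the benign nodes on the shortest path between $i_{\tau'}$ and $\hat{i}$, where the distance between node $i_s$ and $\hat{i}$ is $s$. Then at the $k_0$-th iteration node $\hat{i}$ can broadcast to its neighbors the following estimate to achieve this goal in $\tau'$ iterations: $$x = x_{k_0,\hat{i}} + \hat{x}\prod_{s=1}^{\tau'}\bigl(|\mathcal{N}_{i_s}|+1\bigr),$$ where $|\mathcal{N}_{i_s}|$ is the number of neighbors of node $i_s$. That is, writing $x_{k,i}$ for the estimates in the execution without this attack and $\hat{x}_{k,i}$ for the estimates in the attacked execution, $$\hat{x}_{k_0+\tau',\,i_{\tau'}} = x_{k_0+\tau',\,i_{\tau'}} + \hat{x}.$$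
   Context: A decentralized system is an undirected graph $\mathcal{G}=(V,E)$ whose vertices are the nodes and whose edges are communication links; $\mathcal{N}_i=\{j : (i,j)\in E\}$ is the set of neighbors of node $i$. Nodes are either benign (following the protocol) or Byzantine (able to send arbitrary vectors to their neighbors). At iteration $k$ each node $i$ holds an estimate $x_{k,i}\in\mathbb{R}^d$, broadcasts it to its neighbors, and receives the estimates of its neighbors. Let $l(x,\xi)$ be the loss function, $\lambda$ the learning rate (the same for all nodes), and $\xi_{k,i}$ the data sample used by node $i$ at iteration $k$. Node $i$ updates its estimate by the general update function $$x_{k+1,i}=\alpha x_{k,i}+(1-\alpha)\,\mathcal{R}(x_{k,j}, j\in\mathcal{N}_i)-\lambda\nabla l(x_{k,i},\xi_{k,i}),$$ where $\mathcal{R}$ is an aggregation rule applied to the received vectors. The average aggregation rule is $\mathcal{R}_{Average}=\frac{1}{|\mathcal{N}_i|}\sum_{j\in\mathcal{N}_i}x_{k,j}$, with $\alpha=\frac{1}{|\mathcal{N}_i|+1}$, so that $$x_{k+1,i}=\frac{1}{|\mathcal{N}_i|+1}\Bigl(x_{k,i}+\sum_{j\in\mathcal{N}_i}x_{k,j}\Bigr)-\lambda\nabla l(x_{k,i},\xi_{k,i}).$$ Here $x_{k_0,\hat{i}}$ is the benign estimate that $\hat{i}$ would send to its neighbors at iteration $k_0$ if it were not controlled by the adversary. In the non-attacked execution every node follows the average-rule update and broadcasts its true estimate. In the attacked execution (same graph, loss, learning rate, data samples, and same estimates up to and including iteration $k_0$) the message broadcast by $\hat{i}$ at iteration $k_0$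 is replaced by $x$, while benign nodes keep following the average-rule update with the vectors they receive and broadcast the resulting estimates.
   Formalization: The shortest path between the Byzantine node and the target is assumed unique (on a 4-cycle with distance 2 the target would receive twice the malicious vector), and in the attacked execution all nodes other than the attacker follow the average rule. *)

theory Defs
  imports "HOL-Analysis.Analysis" "Graph_Theory.Graph_Theory"
begin

text \<open>Hop distance: the weighted distance with every arc of weight 1.\<close>
definition hop_dist :: "'v pair_pre_digraph \<Rightarrow> 'v \<Rightarrow> 'v \<Rightarrow> ereal" where
  "hop_dist G u v = wf_digraph.\<mu> (with_proj G) (\<lambda>_. 1) u v"

definition shortest_path :: "'v pair_pre_digraph \<Rightarrow> 'v \<Rightarrow> 'v vwalk \<Rightarrow> 'v \<Rightarrow> bool" where
  "shortest_path G u p v \<longleftrightarrow>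
     vpath p (with_proj G) \<and> hd p = u \<and> last p = v \<and>
     ereal (real (vwalk_length p)) = hop_dist G u v"

definition neighbors :: "'v pair_pre_digraph \<Rightarrow> 'v \<Rightarrow> 'v set" where
  "neighbors G i = {j. (i, j) \<in> parcs G}"

text \<open>The gradient of a real-valued function; unspecified where it does not exist
  (compare \<^const>\<open>deriv\<close>).\<close>
definition gradient :: "('a::real_inner \<Rightarrow> real) \<Rightarrow> 'a \<Rightarrow> 'a" where
  "gradient f x = (SOME D. GDERIV f x :> D)"

lemma gradient_eq:
  assumes "GDERIV f x :> D"
  shows "gradient f x = D"
  unfolding gradient_def
proof (rule some_equality)
  show "GDERIV f x :> D" by (rule assms)
next
  fix D' assume "GDERIV f x :> D'"
  then have "(\<lambda>h. h \<bullet> D') = (\<lambda>h. h \<bullet> D)"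
    using assms unfolding gderiv_def by (rule has_derivative_unique)
  then have "h \<bullet> D' = h \<bullet> D" for h by (rule fun_cong)
  then show "D' = D" by (metis inner_commute vector_eq_rdot)
qed

definition average_rule :: "'v set \<Rightarrow> ('v \<Rightarrow> 'a::real_vector) \<Rightarrow> 'a" where
  "average_rule N y = (1 / real (card N)) *\<^sub>R (\<Sum>j\<in>N. y j)"

text \<open>One step of the general update function, with weight \<open>\<alpha>\<close>, aggregation rule \<open>R\<close>,
  received vectors \<open>y\<close>, learning rate \<open>\<eta>\<close>, own estimate \<open>x\<close> and data sample \<open>s\<close>.\<close>
definition general_update ::
  "real \<Rightarrow> ('v set \<Rightarrow> ('v \<Rightarrow> 'a) \<Rightarrow> 'a) \<Rightarrow> ('a \<Rightarrow> 's \<Rightarrow> real) \<Rightarrow> real \<Rightarrow>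
   'v set \<Rightarrow> ('v \<Rightarrow> 'a) \<Rightarrow> 'a \<Rightarrow> 's \<Rightarrow> 'a::real_inner" where
  "general_update \<alpha> R l \<eta> N y x s =
     \<alpha> *\<^sub>R x + (1 - \<alpha>) *\<^sub>R R N y - \<eta> *\<^sub>R gradient (\<lambda>z. l z s) x"

definition average_update ::
  "('a \<Rightarrow> 's \<Rightarrow> real) \<Rightarrow> real \<Rightarrow> 'v set \<Rightarrow> ('v \<Rightarrow> 'a) \<Rightarrow> 'a \<Rightarrow> 's \<Rightarrow> 'a::real_inner" where
  "average_update l \<eta> N = general_update (1 / (real (card N) + 1)) average_rule l \<eta> N"

lemma average_update_eq:
  assumes "finite N"
  shows "average_update l \<eta> N y x s =
    (1 / (real (card N) + 1)) *\<^sub>R (x + (\<Sum>j\<in>N. y j)) - \<eta> *\<^sub>R gradient (\<lambda>z. l z s) x"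
proof (cases "N = {}")
  case True
  then show ?thesis by (simp add: average_update_def general_update_def)
next
  case False
  then have "real (card N) > 0" using assms by (simp add: card_gt_0_iff)
  then have "(1 - 1 / (real (card N) + 1)) * (1 / real (card N)) = 1 / (real (card N) + 1)"
    by (simp add: field_simps)
  then show ?thesis
    by (simp only: average_update_def general_update_def average_rule_def
        scaleR_scaleR scaleR_add_right)
qed

text \<open>Estimates \<open>x k i\<close> and broadcast messages \<open>m k i\<close> are indexed by iteration and node.
  Node \<open>i\<close> behaves correctly at iteration \<open>k\<close> if it broadcasts its true estimate and updates it
  with the messages it receives.\<close>
definition follows_protocol ::
  "'v pair_pre_digraph \<Rightarrow> ('a \<Rightarrow> 's \<Rightarrow> real) \<Rightarrow> real \<Rightarrow> (nat \<Rightarrow> 'v \<Rightarrow> 's) \<Rightarrow>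
   (nat \<Rightarrow> 'v \<Rightarrow> 'a::real_inner) \<Rightarrow> (nat \<Rightarrow> 'v \<Rightarrow> 'a) \<Rightarrow> nat \<Rightarrow> 'v \<Rightarrow> bool" where
  "follows_protocol G l \<eta> \<xi> x m k i \<longleftrightarrow>
     m k i = x k i \<and>
     x (Suc k) i = average_update l \<eta> (neighbors G i) (m k) (x k i) (\<xi> k i)"

definition non_attacked_execution ::
  "'v pair_pre_digraph \<Rightarrow> ('a \<Rightarrow> 's \<Rightarrow> real) \<Rightarrow> real \<Rightarrow> (nat \<Rightarrow> 'v \<Rightarrow> 's) \<Rightarrow>
   (nat \<Rightarrow> 'v \<Rightarrow> 'a::real_inner) \<Rightarrow> bool" where
  "non_attacked_execution G l \<eta> \<xi> x \<longleftrightarrow>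
     (\<forall>k. \<forall>i\<in>pverts G. follows_protocol G l \<eta> \<xi> x x k i)"

text \<open>Node \<open>a\<close> broadcasts \<open>v\<close> at iteration \<open>k\<^sub>0\<close> of an execution with non-attacked estimates \<open>x\<close>;
  \<open>x'\<close> and \<open>m\<close> are the resulting estimates and messages.  Whatever \<open>a\<close> does at later iterations
  is left unconstrained; nobody else attacks.\<close>
definition attacked_execution ::
  "'v pair_pre_digraph \<Rightarrow> ('a \<Rightarrow> 's \<Rightarrow> real) \<Rightarrow> real \<Rightarrow> (nat \<Rightarrow> 'v \<Rightarrow> 's) \<Rightarrow>
   (nat \<Rightarrow> 'v \<Rightarrow> 'a::real_inner) \<Rightarrow> nat \<Rightarrow> 'v \<Rightarrow> 'a \<Rightarrow>
   (nat \<Rightarrow> 'v \<Rightarrow> 'a) \<Rightarrow> (nat \<Rightarrow> 'v \<Rightarrow> 'a) \<Rightarrow> bool" where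
  "attacked_execution G l \<eta> \<xi> x k\<^sub>0 a v x' m \<longleftrightarrow>
     (\<forall>k\<le>k\<^sub>0. \<forall>i\<in>pverts G. x' k i = x k i) \<and>
     m k\<^sub>0 a = v \<and>
     (\<forall>k\<ge>k\<^sub>0. \<forall>i\<in>pverts G - {a}. follows_protocol G l \<eta> \<xi> x' m k i)"

end

theory Submission
  imports Defs
begin

text \<open>The perturbation travels one hop per iteration.  Estimates at distance more than \<open>t\<close> from
  the attacker are still untouched at iteration \<open>k\<^sub>0 + t\<close>.  Hence, when \<open>i\<^sub>s\<^sub>+\<^sub>1\<close> first feels the
  attack, its own estimate, and so its gradient, is the original one, and only messages from
  neighbours at distance exactly \<open>s\<close> can differ.  Uniqueness of the shortest path leaves \<open>i\<^sub>s\<close> as the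
  only such neighbour, so averaging divides the perturbation by the degree plus one.  The
  factor in the broadcast vector cancels these divisions.\<close>

context pair_graph
begin

lemma awalk_cost_unit: "awalk_cost (\<lambda>_. 1) p = real (length p)"
  by (induction p) auto

text \<open>The empty walk is the witness. This bound is what tells the attacker apart from any node
  at positive distance.\<close>

lemma hop_dist_self_le: "u \<in> pverts G \<Longrightarrow> hop_dist G u u \<le> 0"
  unfolding hop_dist_def
  using min_cost_le_walk_cost[of u "[]" u "\<lambda>_. 1"] by (simp add: awalk_Nil_iff zero_ereal_def)

lemma hop_dist_arc:
  assumes "(v, w) \<in> parcs G"
  shows "hop_dist G u w \<le> hop_dist G u v + 1"
  unfolding hop_dist_def
  using pos_cost_mu_triangle[of "\<lambda>_. 1" "(v, w)" v w u] assms
  by (simp add: arc_to_ends_def one_ereal_def)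

text \<open>Induction goes from the end of the walk, because the triangle inequality
  \<open>hop_dist_arc\<close> moves the target and keeps the source fixed.\<close>

lemma hop_dist_le_vwalk:
  assumes "vwalk p (with_proj G)"
  shows "hop_dist G (hd p) (last p) \<le> ereal (real (vwalk_length p))"
  using assms
proof (induction p rule: rev_induct)
  case Nil
  then show ?case by auto
next
  case (snoc w p)
  show ?case
  proof (cases "p = []")
    case True
    then show ?thesis using snoc.prems hop_dist_self_le[of w] by (auto simp: zero_ereal_def)
  next
    case False
    then have p: "vwalk p (with_proj G)" using snoc.prems by (rule vwalkI_append_l)
    have "(last p, w) \<in> parcs G"
      using snoc.prems False by (auto simp: vwalk_def set_vwalk_arcs_snoc)
    then have "hop_dist G (hd p) w \<le> hop_dist G (hd p) (last p) + 1" by (rule hop_dist_arc)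
    also have "\<dots> \<le> ereal (real (length p - 1)) + 1"
      using snoc.IH[OF p] by (intro add_right_mono) simp
    also have "\<dots> = ereal (real (length p))"
      using False by (cases p) (auto simp: one_ereal_def)
    finally show ?thesis using False by simp
  qed
qed

lemma vwalk_append_iff:
  assumes "p \<noteq> []" "q \<noteq> []"
  shows "vwalk (p @ q) (with_proj G) \<longleftrightarrow>
    vwalk p (with_proj G) \<and> (last p, hd q) \<in> parcs G \<and> vwalk q (with_proj G)"
  using assms by (auto simp: vwalk_def vwalk_arcs_append)

text \<open>A repeated vertex would allow the cycle between its two occurrences to be cut out,
  leaving a walk shorter than the distance. So a uniqueness hypothesis on paths can be applied to
  walks glued from pieces.\<close>

lemma shortest_pathI:
  assumes "vwalk p (with_proj G)" "hd p = u" "last p = v"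
    and len: "ereal (real (vwalk_length p)) = hop_dist G u v"
  shows "shortest_path G u p v"
proof -
  have "distinct p"
  proof (rule ccontr)
    assume "\<not> distinct p"
    then obtain xs ys zs y where p: "p = xs @ [y] @ ys @ [y] @ zs"
      using not_distinct_decomp by blast
    let ?q = "xs @ [y] @ zs"
    have yzs: "vwalk (y # zs) (with_proj G)"
      using assms(1) vwalkI_append_r[of "y # zs" "xs @ y # ys"] p by simp
    have "vwalk ?q (with_proj G)"
      using assms(1) yzs unfolding p
      by (cases "xs = []") (auto simp: vwalk_append_iff)
    moreover have "hd ?q = u" using assms(2) p by (cases xs) auto
    moreover have "last ?q = v" using assms(3) p by (cases zs) auto
    ultimately have "hop_dist G u v \<le> ereal (real (vwalk_length ?q))"
      using hop_dist_le_vwalk by blast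
    then show False unfolding len[symmetric] p by simp
  qed
  then show ?thesis using assms by (auto simp: shortest_path_def)
qed

text \<open>Finite distance means reachability, and with nonnegative weights the infimum over walks
  is then attained.\<close>

lemma ex_vwalk_hop_dist:
  assumes "hop_dist G u v = ereal r"
  obtains p where "vwalk p (with_proj G)" "hd p = u" "last p = v"
    "ereal (real (vwalk_length p)) = hop_dist G u v"
proof -
  have "u \<rightarrow>\<^sup>*\<^bsub>with_proj G\<^esub> v"
    using assms \<mu>_reach_conv[of "\<lambda>_. 1" u v] by (simp add: hop_dist_def)
  then obtain p where p: "apath u p v" "hop_dist G u v = ereal (real (length p))"
    using min_cost_awalk[of u v "\<lambda>_. 1"] by (auto simp: hop_dist_def awalk_cost_unit)
  then have w: "awalk u p v" by (simp add: apath_def)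
  have "length (pawalk_verts u p) = Suc (length p)" for u
    by (induction p arbitrary: u) auto
  with that[of "pawalk_verts u p"] show ?thesis
    using awalk_imp_vwalk[OF w] w p(2) by (auto simp: awalk_def)
qed

text \<open>Glue a shortest walk from \<open>u\<close> to \<open>w\<close> to the part of
  \<open>P\<close> from position \<open>Suc s\<close> on. The result is as long as \<open>P\<close>,
  hence a shortest path, hence \<open>P\<close> itself, and its entry at position \<open>s\<close>
  is \<open>w\<close>.\<close>

lemma unique_shortest_path_predecessor:
  assumes P: "shortest_path G u P v"
    and unique: "\<And>p. shortest_path G u p v \<Longrightarrow> p = P"
    and s: "Suc s < length P"
    and arc: "(w, P ! Suc s) \<in> parcs G"
    and dist: "hop_dist G u w = ereal (real s)"
  shows "w = P ! s"
proof -
  obtain p where p: "vwalk p (with_proj G)" "hd p = u" "last p = w"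
    "ereal (real (vwalk_length p)) = hop_dist G u w"
    using ex_vwalk_hop_dist[OF dist] .
  have ne: "p \<noteq> []" using p(1) by auto
  have len: "length p = Suc s" using p(4) dist ne by (cases p) auto
  let ?q = "drop (Suc s) P"
  have q: "?q \<noteq> []" "hd ?q = P ! Suc s" "last ?q = v"
    using s P by (auto simp: hd_drop_conv_nth shortest_path_def)
  have "vwalk (take (Suc s) P @ ?q) (with_proj G)"
    using P by (auto simp: shortest_path_def)
  then have "vwalk ?q (with_proj G)" using q(1) by (rule vwalkI_append_r[rotated])
  then have "vwalk (p @ ?q) (with_proj G)"
    using p arc q ne by (simp add: vwalk_append_iff)
  moreover have "ereal (real (vwalk_length (p @ ?q))) = hop_dist G u v"
    using P len s by (auto simp: shortest_path_def)
  ultimately have "shortest_path G u (p @ ?q) v"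
    using p q ne by (intro shortest_pathI) auto
  then have "P = p @ ?q" by (rule unique[symmetric])
  then have "P ! s = (p @ ?q) ! s" by simp
  also have "\<dots> = w" using len p(3) ne by (simp add: nth_append last_conv_nth)
  finally show ?thesis by simp
qed

lemma finite_neighbors: "finite (neighbors G v)"
  unfolding neighbors_def
  by (rule finite_subset[of _ "snd ` parcs G"]) (auto intro: rev_image_eqI pair_finite_arcs)

lemma neighborsD:
  assumes "j \<in> neighbors G v"
  shows "(v, j) \<in> parcs G" "(j, v) \<in> parcs G" "j \<in> pverts G"
proof -
  show arc: "(v, j) \<in> parcs G" using assms by (simp add: neighbors_def)
  then show "(j, v) \<in> parcs G" by (rule arcs_symmetric)
  show "j \<in> pverts G" using arc arc_snd_in_verts by fastforce
qed

lemma hop_dist_neighbor: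
  assumes "j \<in> neighbors G v" "hop_dist G u v > ereal (real (Suc t))"
  shows "hop_dist G u j > ereal (real t)"
proof (rule ccontr)
  assume "\<not> ?thesis"
  then have "hop_dist G u j + 1 \<le> ereal (real t) + 1" by (intro add_right_mono) simp
  with hop_dist_arc[OF neighborsD(2)[OF assms(1)], of u] assms(2) show False
    by (auto simp: one_ereal_def add.commute dest: order.trans)
qed

lemma attacked_execution_unaffected:
  assumes "non_attacked_execution G l \<eta> \<xi> x"
    and "attacked_execution G l \<eta> \<xi> x k\<^sub>0 a v x' m"
    and a: "a \<in> pverts G"
    and "j \<in> pverts G" "hop_dist G a j > ereal (real t)"
  shows "x' (k\<^sub>0 + t) j = x (k\<^sub>0 + t) j" "m (k\<^sub>0 + t) j = x (k\<^sub>0 + t) j"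
proof -
  \<comment> \<open>Distance above \<open>t\<close> is positive, so \<open>j\<close> is not the
    attacker, whose behaviour after \<open>k\<^sub>0\<close> is arbitrary.\<close>
  have benign: "follows_protocol G l \<eta> \<xi> x' m (k\<^sub>0 + t) j"
    if "j \<in> pverts G" "hop_dist G a j > ereal (real t)" for j t
  proof -
    have "ereal 0 \<le> ereal (real t)" by simp
    also note that(2)
    finally have "j \<noteq> a" using hop_dist_self_le[OF a] by (auto simp: zero_ereal_def)
    then show ?thesis using assms(2) that by (simp add: attacked_execution_def)
  qed
  \<comment> \<open>Neighbours of a node farther than \<open>t + 1\<close> are farther than
    \<open>t\<close>, so by induction everything that enters its update is unchanged.\<close>
  have main: "x' (k\<^sub>0 + t) j = x (k\<^sub>0 + t) j"
    if "j \<in> pverts G" "hop_dist G a j > ereal (real t)" for j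
    using that
  proof (induction t arbitrary: j)
    case 0
    then show ?case using assms(2) by (simp add: attacked_execution_def)
  next
    case (Suc t)
    have "ereal (real t) < ereal (real (Suc t))" by simp
    also note Suc.prems(2)
    finally have far: "hop_dist G a j > ereal (real t)" .
    have "m (k\<^sub>0 + t) i = x (k\<^sub>0 + t) i" if "i \<in> neighbors G j" for i
      using hop_dist_neighbor[OF that Suc.prems(2)] neighborsD(3)[OF that] Suc.IH[of i] benign[of i t]
      by (simp add: follows_protocol_def)
    then show ?case
      using benign[OF Suc.prems(1) far] Suc.IH[OF Suc.prems(1) far] assms(1) Suc.prems(1)
      by (simp add: follows_protocol_def non_attacked_execution_def average_update_eq finite_neighbors)
  qed
  show "x' (k\<^sub>0 + t) j = x (k\<^sub>0 + t) j" using assms by (intro main)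
  with benign[of j t] assms show "m (k\<^sub>0 + t) j = x (k\<^sub>0 + t) j"
    by (simp add: follows_protocol_def)
qed

end

text \<open>The update is affine in the received messages, each with the same weight, and its
  gradient term sees only the own estimate \<open>x\<close>.\<close>

lemma average_update_perturb_one:
  assumes "finite N" "w \<in> N" "y' w = y w + d" "\<And>j. j \<in> N \<Longrightarrow> j \<noteq> w \<Longrightarrow> y' j = y j"
  shows "average_update l \<eta> N y' x s =
    average_update l \<eta> N y x s + (1 / (real (card N) + 1)) *\<^sub>R d"
proof -
  have "(\<Sum>j\<in>N. y' j) = y' w + (\<Sum>j\<in>N - {w}. y' j)" using assms by (simp add: sum.remove)
  also have "(\<Sum>j\<in>N - {w}. y' j) = (\<Sum>j\<in>N - {w}. y j)" using assms by (intro sum.cong) auto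
  also have "y' w + \<dots> = (\<Sum>j\<in>N. y j) + d" using assms by (simp add: sum.remove)
  finally show ?thesis
    using assms(1) by (simp add: average_update_eq scaleR_add_right)
qed

theorem theorem1:
  fixes G :: "'v pair_pre_digraph"
    and benign :: "'v set"
    and l :: "real ^ 'd \<Rightarrow> 's \<Rightarrow> real"
    and \<eta> :: real
    and \<xi> :: "nat \<Rightarrow> 'v \<Rightarrow> 's"
    and i_hat :: 'v
    and i :: "nat \<Rightarrow> 'v"
    and \<tau> k\<^sub>0 :: nat
    and x_hat :: "real ^ 'd"
    and x x' m :: "nat \<Rightarrow> 'v \<Rightarrow> real ^ 'd"
  assumes "pair_graph G"
    and "benign \<subseteq> pverts G"
    and "i_hat \<in> pverts G - benign"
    and "i \<tau> \<in> benign"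
    and "hop_dist G i_hat (i \<tau>) = ereal (real \<tau>)"
    and "\<And>s. s \<in> {1..<\<tau>} \<Longrightarrow> i s \<in> benign"
    and "\<And>s. s \<in> {1..<\<tau>} \<Longrightarrow> hop_dist G i_hat (i s) = ereal (real s)"
    and "shortest_path G i_hat (i_hat # map i [1..<Suc \<tau>]) (i \<tau>)"
    and "\<And>p. shortest_path G i_hat p (i \<tau>) \<Longrightarrow> p = i_hat # map i [1..<Suc \<tau>]"
    and "non_attacked_execution G l \<eta> \<xi> x"
    and "attacked_execution G l \<eta> \<xi> x k\<^sub>0 i_hat
           (x k\<^sub>0 i_hat + (\<Prod>s=1..\<tau>. (real (card (neighbors G (i s))) + 1)) *\<^sub>R x_hat) x' m"
  shows "x' (k\<^sub>0 + \<tau>) (i \<tau>) = x (k\<^sub>0 + \<tau>) (i \<tau>) + x_hat"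
proof -
  interpret pair_graph G by fact
  define c where "c r = real (card (neighbors G (i r))) + 1" for r
  \<comment> \<open>Position \<open>s\<close> of \<open>P\<close> holds the node at distance
    \<open>s\<close>; the attacker takes position 0, where \<open>i 0\<close> would not
    serve.\<close>
  define P where "P = i_hat # map i [1..<Suc \<tau>]"
  have P: "shortest_path G i_hat P (i \<tau>)" and
    unique: "\<And>p. shortest_path G i_hat p (i \<tau>) \<Longrightarrow> p = P"
    unfolding P_def by (fact assms(8), rule assms(9))
  have i_hat: "i_hat \<in> pverts G" using assms(3) by simp
  have P_Suc: "P ! Suc s = i (Suc s)" if "Suc s \<le> \<tau>" for s
    using that by (simp add: P_def del: upt_Suc)
  have i_verts: "i s \<in> pverts G" and dist: "hop_dist G i_hat (i s) = ereal (real s)"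
    if "1 \<le> s" "s \<le> \<tau>" for s
    using assms(2,4-7) that by (cases "s = \<tau>"; force)+
  have i_ne: "i s \<noteq> i_hat" if "1 \<le> s" "s \<le> \<tau>" for s
    using dist[OF that] hop_dist_self_le[OF i_hat] that by (auto simp: zero_ereal_def)
  have protocol: "follows_protocol G l \<eta> \<xi> x' m (k\<^sub>0 + t) j" if "j \<in> pverts G" "j \<noteq> i_hat" for t j
    using assms(11) that by (simp add: attacked_execution_def)

  \<comment> \<open>The perturbation still carries the factors of the nodes ahead. The invariant is
    about messages, not estimates, so that the attacker's broadcast is the base case; at
    \<open>s = \<tau>\<close> the product is empty.\<close>
  have "m (k\<^sub>0 + s) (P ! s) = x (k\<^sub>0 + s) (P ! s) + (\<Prod>r=Suc s..\<tau>. c r) *\<^sub>R x_hat" if "s \<le> \<tau>" for s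
    using that
  proof (induction s)
    case 0
    then show ?case using assms(11) by (simp add: attacked_execution_def P_def c_def)
  next
    case (Suc s)
    define v where "v = i (Suc s)"
    have v: "P ! Suc s = v" using Suc.prems by (simp add: v_def P_Suc)
    have v_verts: "v \<in> pverts G" and v_dist: "hop_dist G i_hat v = ereal (real (Suc s))"
      and v_ne: "v \<noteq> i_hat"
      using Suc.prems i_verts dist i_ne by (simp_all add: v_def)
    have len: "Suc s < length P" using Suc.prems by (simp add: P_def)
    have "vwalk (take (Suc s) P @ drop (Suc s) P) (with_proj G)"
      using P by (auto simp: shortest_path_def)
    then have "(last (take (Suc s) P), hd (drop (Suc s) P)) \<in> parcs G"
      using len by (subst (asm) vwalk_append_iff) auto
    then have pred: "P ! s \<in> neighbors G v"
      using len v arcs_symmetric by (auto simp: hd_drop_conv_nth take_Suc_conv_app_nth neighbors_def)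
    \<comment> \<open>The triangle inequality puts each neighbour of \<open>v\<close> at distance at
      least \<open>s\<close>, and uniqueness of the path excludes \<open>s\<close> itself for all
      but \<open>P ! s\<close>.\<close>
    have others: "m (k\<^sub>0 + s) j = x (k\<^sub>0 + s) j" if j: "j \<in> neighbors G v" "j \<noteq> P ! s" for j
    proof (rule attacked_execution_unaffected(2)[OF assms(10,11) i_hat])
      show "j \<in> pverts G" using j(1) by (rule neighborsD)
      have "hop_dist G i_hat j \<noteq> ereal (real s)"
        using unique_shortest_path_predecessor[OF P unique len, of j] j neighborsD(2)[OF j(1)] v by auto
      moreover have "ereal (real (Suc s)) \<le> hop_dist G i_hat j + 1"
        using hop_dist_arc[OF neighborsD(2)[OF j(1)], of i_hat] v_dist by simp
      then have "ereal (real s) \<le> hop_dist G i_hat j"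
        by (cases "hop_dist G i_hat j") (auto simp: one_ereal_def)
      ultimately show "ereal (real s) < hop_dist G i_hat j" by simp
    qed
    have own: "x' (k\<^sub>0 + s) v = x (k\<^sub>0 + s) v"
      using attacked_execution_unaffected(1)[OF assms(10,11) i_hat v_verts] v_dist by simp
    \<comment> \<open>The factor split off here is the divisor in the averaging step at
      \<open>v\<close>.\<close>
    have prod: "(\<Prod>r=Suc s..\<tau>. c r) = c (Suc s) * (\<Prod>r=Suc (Suc s)..\<tau>. c r)"
      using Suc.prems by (rule prod.atLeast_Suc_atMost)
    have "c (Suc s) > 0" by (simp add: c_def add_nonneg_pos)
    have "x' (k\<^sub>0 + Suc s) v =
      average_update l \<eta> (neighbors G v) (m (k\<^sub>0 + s)) (x (k\<^sub>0 + s) v) (\<xi> (k\<^sub>0 + s) v)"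
      using protocol[OF v_verts v_ne, of s] own by (simp add: follows_protocol_def)
    also have "\<dots> = average_update l \<eta> (neighbors G v) (x (k\<^sub>0 + s)) (x (k\<^sub>0 + s) v) (\<xi> (k\<^sub>0 + s) v)
        + (1 / c (Suc s)) *\<^sub>R ((\<Prod>r=Suc s..\<tau>. c r) *\<^sub>R x_hat)"
      unfolding c_def v_def[symmetric]
      using Suc.IH Suc.prems
      by (intro average_update_perturb_one[where w = "P ! s"] finite_neighbors pred others)
        (simp_all add: c_def)
    also have "\<dots> = x (k\<^sub>0 + Suc s) v + (\<Prod>r=Suc (Suc s)..\<tau>. c r) *\<^sub>R x_hat"
      using assms(10) v_verts \<open>c (Suc s) > 0\<close>
      by (simp add: prod non_attacked_execution_def follows_protocol_def)
    finally show ?case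
      using protocol[OF v_verts v_ne, of "Suc s"] v by (simp add: follows_protocol_def)
  qed
  from this[of \<tau>] have "m (k\<^sub>0 + \<tau>) (P ! \<tau>) = x (k\<^sub>0 + \<tau>) (P ! \<tau>) + x_hat" by simp
  \<comment> \<open>For \<open>\<tau> = 0\<close> the path is the attacker alone, and its endpoint
    condition gives \<open>i 0 = i_hat\<close>.\<close>
  moreover have "P ! \<tau> = i \<tau>"
    using P P_Suc by (cases \<tau>) (auto simp: shortest_path_def P_def simp del: upt_Suc)
  \<comment> \<open>The target is benign, so it differs from \<open>i_hat\<close> and broadcasts its
    true estimate; this turns the invariant into a claim about estimates.\<close>
  moreover have "m (k\<^sub>0 + \<tau>) (i \<tau>) = x' (k\<^sub>0 + \<tau>) (i \<tau>)"
    using protocol[of "i \<tau>" \<tau>] assms(2-4) by (auto simp: follows_protocol_def)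
  ultimately show ?thesis by simp
qed

end
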